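(* Let $W$ be a topological space, $A$ a non-empty open subset of $W$, and $\mathscr{C}$ the closure subalgebra of $2^W$ generated by $A$. Then $\mathscr{C}\cong\mathscr{E}(P)$ (as closure algebras), where $P=P(\infty)$ or $P=P(m,n)$ for some $(m,n)\in J$, and, indexing each atom of $\mathscr{C}$ by the element $p$ of $P$ such that the atom corresponds to $\{p\}$ under this isomorphism (and indexing $A_\infty$ by $\bot$): (i) if $A_\infty=\emptyset$, the atoms of $\mathscr{C}$ form a complete trim $P$-partition of $W$; (ii) if $A_\infty\neq\emptyset$, the atoms of $\mathscr{C}$ together with $A_\infty$ form a complete trim $\widetilde{P(\infty)}$-partition of $W$.
   Context: A closure algebra is a Boolean algebra with an operator $x\mapsto\overline{x}$ satisfying $x\subseteq\overline x$, $\overline{\overline x}=\overline x$, $\overline{x\cup y}=\overline x\cup\overline y$, $\overline{0}=0$; for a topological space $W$, $2^W$ is a closure algebra with topological closure. For a poset $P$ (topologised so that lower sets are the closed sets), $\mathscr{E}(P)$ is the closure subalgebra of $2^P$ generated by the lower subsets of $P$, with closure $Q\mapsto\{p\in P: p\le q \text{ for some } q\in Q\}$. $P(\infty)$ is the poset $\{p_k\mid k\ge0\}$ with $p_j>p_k$ iff $k\ge j+2$; $\widetilde{P(\infty)}=P(\infty)\cup\{\bot\}$ with the additional relations $p_k>\bot$ for all $k$. $J=\mathbb{N}\times\{0,2\}$ (with $0\in\mathbb N$); for $m\ge0$, $P(m,0)=\{p_0,\dots,p_m\}$ and $P(m,2)=P(m,0)\cup\{p_{m+2}\}$, with the order inherited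 from $P(\infty)$. For $A\subseteq W$, $A_\infty=W-\bigcup\{B: B$ an atom of the closure subalgebra of $2^W$ generated by $A\}$. Partition notions: for a poset $P$ and topological space $W$, a $P$-partition is a family $\{X_p\mid p\in P\}$ of pairwise disjoint non-empty subsets of $W$; complete if their union is $W$. For $Y\subseteq W$, $T(Y)=\{p: Y\cap X_p\ne\emptyset\}$; an open $A$ is $p$-trim ($t(A)=p$) if $T(A)=\{q: q\ge p\}$, trim if $p$-trim for some $p$. $\widehat P$ is the set of $p$ for which a $p$-trim set exists. The partition is semi-trim if every point of $W$ has a neighbourhood base of trim sets; if $A$ open and $p\in T(A)\cap\widehat P$ then $A$ contains a $p$-trim subset; if $x\in X_p$ then $p=\sup\{t(A): A\text{ trim}, x\in A\}$; and every point with a neighbourhood base of $p$-trim sets lies in $X_p$. It is trim if moreover every $x\in X_p$ has a $p$-trim neighbourhood. *)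

theory Defs
  imports "HOL-Analysis.Analysis" "HOL-Library.Disjoint_Sets" "HOL-Algebra.Order"
begin

(* HOL-Algebra uses the same name as the topological closure operator. *)
no_notation eq_closure_of (\<open>closure'_of\<index>\<close>)

section \<open>Closure subalgebras of the closure algebra of all subsets of a space\<close>

definition closure_subalgebra :: "'a topology \<Rightarrow> 'a set set \<Rightarrow> bool" where
  "closure_subalgebra W C \<longleftrightarrow>
     C \<subseteq> Pow (topspace W) \<and> {} \<in> C \<and> topspace W \<in> C \<and>
     (\<forall>a\<in>C. \<forall>b\<in>C. a \<union> b \<in> C \<and> a \<inter> b \<in> C) \<and>
     (\<forall>a\<in>C. topspace W - a \<in> C) \<and>
     (\<forall>a\<in>C. W closure_of a \<in> C)"

abbreviation generated_closure_subalgebra :: "'a topology \<Rightarrow> 'a set set \<Rightarrow> 'a set set" where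
  "generated_closure_subalgebra W G \<equiv> closure_subalgebra W hull G"

definition closure_algebra_iso ::
    "'a topology \<Rightarrow> 'a set set \<Rightarrow> 'b topology \<Rightarrow> 'b set set \<Rightarrow> ('a set \<Rightarrow> 'b set) \<Rightarrow> bool" where
  "closure_algebra_iso W C V D f \<longleftrightarrow>
     bij_betw f C D \<and> f {} = {} \<and> f (topspace W) = topspace V \<and>
     (\<forall>a\<in>C. \<forall>b\<in>C. f (a \<union> b) = f a \<union> f b \<and> f (a \<inter> b) = f a \<inter> f b) \<and>
     (\<forall>a\<in>C. f (topspace W - a) = topspace V - f a) \<and>
     (\<forall>a\<in>C. f (W closure_of a) = V closure_of f a)"

definition atoms :: "'a set set \<Rightarrow> 'a set set" where
  "atoms C = {B \<in> C. B \<noteq> {} \<and> (\<forall>D\<in>C. D \<subseteq> B \<longrightarrow> D = {} \<or> D = B)}"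

definition residue_infinity :: "'a topology \<Rightarrow> 'a set \<Rightarrow> 'a set" where
  "residue_infinity W A = topspace W - \<Union>(atoms (generated_closure_subalgebra W {A}))"

section \<open>Posets as spaces\<close>

definition lower_subset :: "'p gorder \<Rightarrow> 'p set \<Rightarrow> bool" where
  "lower_subset P Q \<longleftrightarrow>
     Q \<subseteq> carrier P \<and> (\<forall>q\<in>Q. \<forall>p\<in>carrier P. p \<sqsubseteq>\<^bsub>P\<^esub> q \<longrightarrow> p \<in> Q)"

definition poset_topology :: "'p gorder \<Rightarrow> 'p topology" where
  "poset_topology P = topology (\<lambda>U. U \<subseteq> carrier P \<and> lower_subset P (carrier P - U))"

definition lower_set_algebra :: "'p gorder \<Rightarrow> 'p set set" (\<open>\<E>\<close>) where
  "\<E> P = generated_closure_subalgebra (poset_topology P) {Q. lower_subset P Q}"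

lemma openin_poset_topology:
  "openin (poset_topology P) U \<longleftrightarrow> U \<subseteq> carrier P \<and> lower_subset P (carrier P - U)"
proof -
  have "istopology (\<lambda>U. U \<subseteq> carrier P \<and> lower_subset P (carrier P - U))"
    unfolding istopology_def lower_subset_def by blast
  then show ?thesis
    by (simp add: poset_topology_def)
qed

lemma topspace_poset_topology [simp]: "topspace (poset_topology P) = carrier P"
proof -
  have "openin (poset_topology P) (carrier P)"
    by (simp add: openin_poset_topology lower_subset_def)
  then show ?thesis
    by (auto simp: topspace_def openin_poset_topology)
qed

lemma closedin_poset_topology: "closedin (poset_topology P) Q \<longleftrightarrow> lower_subset P Q"
  by (auto simp: closedin_def openin_poset_topology lower_subset_def double_diff)

lemma closure_of_poset_topology:
  assumes "partial_order P" and "Q \<subseteq> carrier P"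
  shows "poset_topology P closure_of Q = {p \<in> carrier P. \<exists>q\<in>Q. p \<sqsubseteq>\<^bsub>P\<^esub> q}"
proof -
  interpret partial_order P by fact
  let ?D = "{p \<in> carrier P. \<exists>q\<in>Q. p \<sqsubseteq>\<^bsub>P\<^esub> q}"
  show ?thesis
  proof (rule closure_of_unique)
    show "Q \<subseteq> ?D"
      using assms(2) le_refl by blast
    show "closedin (poset_topology P) ?D"
      unfolding closedin_poset_topology lower_subset_def
      using assms(2) by simp (meson le_trans subsetD)
    show "?D \<subseteq> T" if "Q \<subseteq> T" "closedin (poset_topology P) T" for T
      using that unfolding closedin_poset_topology lower_subset_def by blast
  qed
qed

section \<open>The posets\<close>

text \<open>The natural number \<open>k\<close> stands for the element \<open>p\<^sub>k\<close>, so larger indices tend to be lower in the order.\<close>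

definition P_inf :: "nat gorder" where
  "P_inf = \<lparr>carrier = UNIV, eq = (=), le = (\<lambda>k j. k = j \<or> k \<ge> j + 2)\<rparr>"

text \<open>\<open>None\<close> stands for \<open>\<bottom>\<close>.\<close>

definition P_inf_bot :: "nat option gorder" where
  "P_inf_bot = \<lparr>carrier = UNIV, eq = (=),
     le = (\<lambda>x y. case x of None \<Rightarrow> True
                  | Some k \<Rightarrow> (case y of None \<Rightarrow> False | Some j \<Rightarrow> k \<sqsubseteq>\<^bsub>P_inf\<^esub> j))\<rparr>"

definition J :: "(nat \<times> nat) set" where
  "J = UNIV \<times> {0, 2}"

text \<open>Only meant for \<open>(m, n) \<in> J\<close>.\<close>

definition P_fin :: "nat \<Rightarrow> nat \<Rightarrow> nat gorder" where
  "P_fin m n = P_inf\<lparr>carrier := {0..m} \<union> (if n = 2 then {m + 2} else {})\<rparr>"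

lemma partial_order_P_inf: "partial_order P_inf"
  by unfold_locales (auto simp: P_inf_def)

lemma partial_order_P_inf_bot: "partial_order P_inf_bot"
  by unfold_locales (auto simp: P_inf_bot_def P_inf_def split: option.splits)

lemma partial_order_P_fin: "partial_order (P_fin m n)"
  by unfold_locales (auto simp: P_fin_def P_inf_def)

section \<open>Partitions indexed by a poset\<close>

definition poset_partition :: "'p gorder \<Rightarrow> 'a topology \<Rightarrow> ('p \<Rightarrow> 'a set) \<Rightarrow> bool" where
  "poset_partition P W X \<longleftrightarrow>
     (\<forall>p\<in>carrier P. X p \<noteq> {} \<and> X p \<subseteq> topspace W) \<and> disjoint_family_on X (carrier P)"

definition complete_partition :: "'p gorder \<Rightarrow> 'a topology \<Rightarrow> ('p \<Rightarrow> 'a set) \<Rightarrow> bool" where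
  "complete_partition P W X \<longleftrightarrow>
     poset_partition P W X \<and> (\<Union>p\<in>carrier P. X p) = topspace W"

definition partition_type :: "'p gorder \<Rightarrow> ('p \<Rightarrow> 'a set) \<Rightarrow> 'a set \<Rightarrow> 'p set" where
  "partition_type P X Y = {p \<in> carrier P. Y \<inter> X p \<noteq> {}}"

text \<open>\<open>p_trim P W X p A\<close> says that \<open>A\<close> is trim with \<open>t(A) = p\<close>.\<close>

definition p_trim :: "'p gorder \<Rightarrow> 'a topology \<Rightarrow> ('p \<Rightarrow> 'a set) \<Rightarrow> 'p \<Rightarrow> 'a set \<Rightarrow> bool" where
  "p_trim P W X p A \<longleftrightarrow>
     p \<in> carrier P \<and> openin W A \<and> partition_type P X A = {q \<in> carrier P. p \<sqsubseteq>\<^bsub>P\<^esub> q}"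

definition trim_set :: "'p gorder \<Rightarrow> 'a topology \<Rightarrow> ('p \<Rightarrow> 'a set) \<Rightarrow> 'a set \<Rightarrow> bool" where
  "trim_set P W X A \<longleftrightarrow> (\<exists>p\<in>carrier P. p_trim P W X p A)"

definition trim_elements :: "'p gorder \<Rightarrow> 'a topology \<Rightarrow> ('p \<Rightarrow> 'a set) \<Rightarrow> 'p set" where
  "trim_elements P W X = {p \<in> carrier P. \<exists>A. p_trim P W X p A}"

definition semi_trim_partition :: "'p gorder \<Rightarrow> 'a topology \<Rightarrow> ('p \<Rightarrow> 'a set) \<Rightarrow> bool" where
  "semi_trim_partition P W X \<longleftrightarrow>
     poset_partition P W X \<and>
     (\<forall>x\<in>topspace W. neighbourhood_base_at x (trim_set P W X) W) \<and>
     (\<forall>A p. openin W A \<and> p \<in> partition_type P X A \<inter> trim_elements P W X \<longrightarrow>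
        (\<exists>B\<subseteq>A. p_trim P W X p B)) \<and>
     (\<forall>p\<in>carrier P. \<forall>x\<in>X p. is_lub P p {q. \<exists>A. p_trim P W X q A \<and> x \<in> A}) \<and>
     (\<forall>p\<in>carrier P. \<forall>x\<in>topspace W.
        neighbourhood_base_at x (p_trim P W X p) W \<longrightarrow> x \<in> X p)"

definition trim_partition :: "'p gorder \<Rightarrow> 'a topology \<Rightarrow> ('p \<Rightarrow> 'a set) \<Rightarrow> bool" where
  "trim_partition P W X \<longleftrightarrow>
     semi_trim_partition P W X \<and>
     (\<forall>p\<in>carrier P. \<forall>x\<in>X p. \<exists>A. p_trim P W X p A \<and> x \<in> A)"

end

theory Submission
  imports Defs
begin

text \<open>
  Put \<open>X 0 = A\<close> and let \<open>X (k + 1)\<close> consist of the points that lie neither in \<open>X 0, \<dots>, X k\<close> nor in the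
  closure of \<open>X k\<close>. Then the closure of \<open>X j\<close> is exactly the complement of
  \<open>X 0 \<union> \<dots> \<union> X (j - 1) \<union> X (j + 1)\<close>, which is the closure rule of \<open>p\<^sub>j\<close> in \<open>P(\<infty>)\<close>. If some \<open>X j\<close> is
  empty, this rule leaves \<open>X (j + 1)\<close> as the only possibly non-empty later stratum, and the strata cover
  \<open>W\<close>; this yields the posets \<open>P(m, 0)\<close> and \<open>P(m, 2)\<close>. The generated algebra consists of the finite
  unions of strata and their complements, so its atoms are the non-empty strata. A point outside all
  strata lies in the closure of each of them, so all its neighbourhoods are \<open>\<bottom>\<close>-trim.
\<close>

section \<open>A criterion for trim partitions\<close>

text \<open>The hypothesis \<open>nbhd\<close> bounds the type of a small neighbourhood of
  \<open>X p\<close> from above, and \<open>adh\<close> forces every open set meeting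
  \<open>X p\<close> to meet each \<open>X q\<close> with \<open>q\<close> above \<open>p\<close>.
  Cutting any such open set down by the neighbourhood from \<open>nbhd\<close> therefore gives a
  \<open>p\<close>-trim set, and all the conditions follow from this one construction.\<close>

lemma trim_partitionI:
  assumes po: "partial_order P" and comp: "complete_partition P W X"
    and nbhd: "\<And>p. p \<in> carrier P \<Longrightarrow>
      \<exists>U. openin W U \<and> X p \<subseteq> U \<and> partition_type P X U \<subseteq> {q \<in> carrier P. p \<sqsubseteq>\<^bsub>P\<^esub> q}"
    and adh: "\<And>p q. \<lbrakk>p \<in> carrier P; q \<in> carrier P; p \<sqsubseteq>\<^bsub>P\<^esub> q\<rbrakk> \<Longrightarrow> X p \<subseteq> W closure_of X q"
  shows "trim_partition P W X"
proof -
  interpret partial_order P by fact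
  have part: "poset_partition P W X" and cover: "(\<Union>p\<in>carrier P. X p) = topspace W"
    using comp by (auto simp: complete_partition_def)
  \<comment> \<open>Besides being \<open>p\<close>-trim, \<open>V\<close> keeps all of
    \<open>U \<inter> X p\<close>. Thus the same statement serves both for neighbourhoods of a point
    and for \<open>p\<close>-trim subsets of an open set.\<close>
  have refine: "\<exists>V\<subseteq>U. p_trim P W X p V \<and> U \<inter> X p \<subseteq> V"
    if U: "openin W U" and p: "p \<in> carrier P" and meets: "U \<inter> X p \<noteq> {}" for U p
  proof -
    obtain N where N: "openin W N" "X p \<subseteq> N"
      "partition_type P X N \<subseteq> {q \<in> carrier P. p \<sqsubseteq>\<^bsub>P\<^esub> q}"
      using nbhd[OF p] by blast
    have op: "openin W (U \<inter> N)"
      using U N(1) by (rule openin_Int)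
    have "U \<inter> N \<inter> X q \<noteq> {}" if "q \<in> carrier P" "p \<sqsubseteq>\<^bsub>P\<^esub> q" for q
    proof -
      obtain x where "x \<in> U \<inter> N" "x \<in> X p"
        using meets N(2) by blast
      then have "x \<in> U \<inter> N \<inter> W closure_of X q"
        using adh[OF p that] by blast
      then show ?thesis
        using openin_Int_closure_of_eq_empty[OF op, of "X q"] by blast
    qed
    then have "p_trim P W X p (U \<inter> N)"
      using op p N(3) by (auto simp: p_trim_def partition_type_def)
    then show ?thesis
      using N(2) by (intro exI[of _ "U \<inter> N"]) blast
  qed
  have trim_at: "\<exists>V\<subseteq>U. p_trim P W X p V \<and> x \<in> V"
    if "openin W U" "p \<in> carrier P" "x \<in> X p" "x \<in> U" for U p x
    using refine[OF that(1,2)] that(3,4) by blast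
  have in_type: "q \<sqsubseteq>\<^bsub>P\<^esub> p"
    if "p_trim P W X q V" "x \<in> V" "p \<in> carrier P" "x \<in> X p" for p q x V
  proof -
    have "p \<in> partition_type P X V"
      using that(2-4) by (auto simp: partition_type_def)
    then show ?thesis
      using that(1) by (simp add: p_trim_def)
  qed
  have sub: "X p \<subseteq> topspace W" if "p \<in> carrier P" for p
    using part that by (auto simp: poset_partition_def)
  have 1: "neighbourhood_base_at x (trim_set P W X) W" if x: "x \<in> topspace W" for x
    unfolding neighbourhood_base_at_def
  proof (intro allI impI)
    fix U assume U: "openin W U \<and> x \<in> U"
    obtain p where p: "p \<in> carrier P" "x \<in> X p"
      using x cover by blast
    obtain V where "V \<subseteq> U" "p_trim P W X p V" "x \<in> V"
      using trim_at U p by metis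
    then show "\<exists>V N. openin W V \<and> trim_set P W X N \<and> x \<in> V \<and> V \<subseteq> N \<and> N \<subseteq> U"
      using p by (auto simp: trim_set_def p_trim_def intro!: exI[of _ V])
  qed
  have 2: "\<exists>V\<subseteq>U. p_trim P W X p V" if "openin W U" "p \<in> partition_type P X U" for U p
    using refine[OF that(1), of p] that(2) by (auto simp: partition_type_def)
  have 5: "\<exists>V. p_trim P W X p V \<and> x \<in> V" if "p \<in> carrier P" "x \<in> X p" for p x
    using trim_at[OF openin_topspace that] sub that by blast
  \<comment> \<open>By \<open>in_type\<close> the trim sets around \<open>x\<close> have types at
    most \<open>p\<close>, and by \<open>5\<close> the type \<open>p\<close> occurs: the supremum is
    a maximum.\<close>
  have 3: "is_lub P p {q. \<exists>V. p_trim P W X q V \<and> x \<in> V}" if "p \<in> carrier P" "x \<in> X p" for p x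
    unfolding least_def Upper_def
    using that 5[OF that] in_type by (auto simp: p_trim_def)
  \<comment> \<open>If \<open>x\<close> lies in \<open>X q\<close>, a \<open>p\<close>-trim
    neighbourhood inside a \<open>q\<close>-trim one gives \<open>q\<close> below \<open>p\<close>,
    while \<open>x\<close> itself gives \<open>p\<close> below \<open>q\<close>; antisymmetry
    concludes.\<close>
  have 4: "x \<in> X p"
    if p: "p \<in> carrier P" and x: "x \<in> topspace W"
      and base: "neighbourhood_base_at x (p_trim P W X p) W" for p x
  proof -
    obtain q where q: "q \<in> carrier P" "x \<in> X q"
      using x cover by blast
    obtain U where U: "p_trim P W X q U" "x \<in> U"
      using 5[OF q] by blast
    then obtain V where V: "p_trim P W X p V" "x \<in> V" "V \<subseteq> U"
      using base unfolding neighbourhood_base_at_def p_trim_def[of _ _ _ q] by blast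
    have "p \<in> partition_type P X V"
      using V(1) p by (simp add: p_trim_def)
    then have "p \<in> partition_type P X U"
      using V(3) by (auto simp: partition_type_def)
    then have "q \<sqsubseteq>\<^bsub>P\<^esub> p"
      using U(1) by (simp add: p_trim_def)
    moreover have "p \<sqsubseteq>\<^bsub>P\<^esub> q"
      using in_type[OF V(1,2) q] .
    ultimately have "p = q"
      using p q(1) le_antisym by (simp add: eq_is_equal)
    then show ?thesis
      using q(2) by simp
  qed
  show ?thesis
    unfolding trim_partition_def semi_trim_partition_def
    using part 1 2 3 4 5 by simp
qed

section \<open>The algebra of a subposet of \<open>P(\<infty>)\<close>\<close>

lemma le_P_inf [simp]: "k \<sqsubseteq>\<^bsub>P_inf\<^esub> j \<longleftrightarrow> k = j \<or> j + 2 \<le> k"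
  by (simp add: P_inf_def)

lemma partial_order_P_inf_carrier: "partial_order (P_inf\<lparr>carrier := K\<rparr>)"
  by unfold_locales (auto simp: P_inf_def)

lemma closure_subalgebra_Union:
  assumes "closure_subalgebra W C" and "finite F" and "F \<subseteq> C"
  shows "\<Union>F \<in> C"
  using assms(2,3,1) by (induction F) (auto simp: closure_subalgebra_def)

text \<open>A lower set containing \<open>q\<close> contains every index of \<open>K\<close> from
  \<open>q + 2\<close> on, so non-empty lower sets are cofinite. Conversely each singleton is a
  difference of two lower sets, and singletons generate the finite and cofinite sets.\<close>

lemma lower_set_algebra_P_inf_carrier:
  "\<E> (P_inf\<lparr>carrier := K\<rparr>) = {S. S \<subseteq> K \<and> (finite S \<or> finite (K - S))}"
  (is "\<E> ?P = ?C")
  unfolding lower_set_algebra_def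
proof (rule hull_unique)
  have lower_cofinite: "Q \<in> ?C" if "lower_subset ?P Q" for Q
  proof (cases "Q = {}")
    case False
    then obtain q where "q \<in> Q"
      by blast
    then have "j \<in> Q" if "j \<in> K" "q + 2 \<le> j" for j
      using \<open>lower_subset ?P Q\<close> that by (auto simp: lower_subset_def)
    then have "K - Q \<subseteq> {..Suc q}"
      by (auto simp flip: not_less_eq_eq)
    then show ?thesis
      using that finite_subset by (auto simp: lower_subset_def)
  qed simp
  then show "{Q. lower_subset ?P Q} \<subseteq> ?C"
    by blast
  have cofinite: "finite (K - (S \<inter> T))" if "finite (K - S)" "finite (K - T)" for S T
    using that by (simp add: Diff_Int)
  \<comment> \<open>A closure is closed, hence a lower set, so \<open>lower_cofinite\<close> also
    settles the closure operation.\<close>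
  have "poset_topology ?P closure_of S \<in> ?C" for S
    by (rule lower_cofinite) (simp flip: closedin_poset_topology)
  then show "closure_subalgebra (poset_topology ?P) ?C"
    unfolding closure_subalgebra_def
    by (auto simp: double_diff intro: cofinite finite_subset[of "K - (_ \<union> _)"])
next
  fix D
  assume lower: "{Q. lower_subset ?P Q} \<subseteq> D" and D: "closure_subalgebra (poset_topology ?P) D"
  have single: "{k} \<in> D" if k: "k \<in> K" for k
  proof -
    \<comment> \<open>The principal lower set of \<open>k\<close> and its strict part, whose
      difference is \<open>{k}\<close>.\<close>
    have "{k} \<union> {j \<in> K. k + 2 \<le> j} \<in> D" "{j \<in> K. k + 2 \<le> j} \<in> D"
      using k by (auto intro!: subsetD[OF lower] simp: lower_subset_def)
    then have "({k} \<union> {j \<in> K. k + 2 \<le> j}) \<inter> (K - {j \<in> K. k + 2 \<le> j}) \<in> D"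
      using D by (simp add: closure_subalgebra_def)
    moreover have "({k} \<union> {j \<in> K. k + 2 \<le> j}) \<inter> (K - {j \<in> K. k + 2 \<le> j}) = {k}"
      using k by auto
    ultimately show ?thesis
      by simp
  qed
  have fin: "S \<in> D" if "finite S" "S \<subseteq> K" for S
    using closure_subalgebra_Union[OF D, of "(\<lambda>k. {k}) ` S"] single that by auto
  have "S \<in> D" if "S \<subseteq> K" "finite (K - S)" for S
  proof -
    have "K - (K - S) \<in> D"
      using D fin[OF that(2)] by (simp add: closure_subalgebra_def)
    then show ?thesis
      using that(1) by (simp add: double_diff)
  qed
  then show "?C \<subseteq> D"
    using fin by blast
qed

section \<open>Strata\<close>

text \<open>The recursion continues past an empty stratum: if \<open>X (m + 1)\<close> is empty,
  then \<open>X (m + 2)\<close> is all that \<open>X 0, \<dots>, X m\<close> leave over. This is the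
  last element of \<open>P(m, 2)\<close> when it is non-empty.\<close>

function stratum :: "'a topology \<Rightarrow> 'a set \<Rightarrow> nat \<Rightarrow> 'a set" where
  "stratum W A 0 = A"
| "stratum W A (Suc k) = topspace W - (\<Union>j\<le>k. stratum W A j) - W closure_of stratum W A k"
  by pat_completeness auto
termination
  by (relation "Wellfounded.measure (\<lambda>(W, A, k). k)") auto

locale open_generator =
  fixes W :: "'a topology" and A :: "'a set"
  assumes openin_generator: "openin W A" and generator_nonempty: "A \<noteq> {}"
begin

abbreviation X :: "nat \<Rightarrow> 'a set" where
  "X \<equiv> stratum W A"

definition below :: "nat \<Rightarrow> 'a set" where
  "below k = (\<Union>j<k. X j)"

text \<open>This becomes the residue of \<open>A\<close> once the atoms are known to be the
  non-empty strata.\<close>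

definition R :: "'a set" where
  "R = topspace W - (\<Union>k. X k)"

definition K :: "nat set" where
  "K = {k. X k \<noteq> {}}"

lemma X_Suc: "X (Suc k) = topspace W - below (Suc k) - W closure_of X k"
  by (simp add: below_def lessThan_Suc_atMost)

lemma below_0 [simp]: "below 0 = {}"
  by (simp add: below_def)

lemma below_Suc: "below (Suc k) = X k \<union> below k"
  by (auto simp: below_def less_Suc_eq)

lemma below_mono: "i \<le> k \<Longrightarrow> below i \<subseteq> below k"
  by (force simp: below_def)

lemma X_subset_below: "i < k \<Longrightarrow> X i \<subseteq> below k"
  by (auto simp: below_def)

declare stratum.simps(2) [simp del]

lemma X_subset_topspace: "X k \<subseteq> topspace W"
  using openin_generator openin_subset by (cases k) (auto simp: X_Suc)

lemma below_subset_topspace: "below k \<subseteq> topspace W"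
  using X_subset_topspace by (auto simp: below_def)

lemma X_disjoint_below: "i \<le> k \<Longrightarrow> X k \<inter> below i = {}"
  using below_mono[of i k] by (cases k) (auto simp: X_Suc)

lemma X_disjoint: "i \<noteq> k \<Longrightarrow> X i \<inter> X k = {}"
  using X_disjoint_below X_subset_below by (metis disjoint_iff le_refl nat_neq_iff subsetD)

lemma X_index_unique: "x \<in> X i \<Longrightarrow> x \<in> X k \<Longrightarrow> i = k"
  using X_disjoint by blast

lemma point_cases:
  assumes "x \<in> topspace W"
  obtains k where "x \<in> X k" | "x \<in> R"
  using assms by (auto simp: R_def)

section \<open>Openness of the initial unions and closures of the strata\<close>

lemma closure_of_X_complement: "topspace W - W closure_of X k \<subseteq> below k \<union> X (Suc k)"
  using closure_of_subset[OF X_subset_topspace, of k] by (auto simp: X_Suc below_Suc)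

lemma openin_below: "openin W (below k)"
proof (induction k)
  case (Suc k)
  show ?case
  proof (cases k)
    case 0
    then show ?thesis
      using openin_generator by (simp add: below_Suc)
  next
    case (Suc j)
    \<comment> \<open>The stratum \<open>X (Suc j)\<close> is caught between two bounds: the open
      set \<open>topspace W - W closure_of X j\<close> contains it and adds only points of
      \<open>below j\<close>.\<close>
    have "below (Suc k) = (topspace W - W closure_of X j) \<union> below k"
      using closure_of_X_complement[of j] below_mono[of j k]
      by (auto simp: Suc below_Suc[of "Suc j"] X_Suc)
    then show ?thesis
      using Suc.IH by (metis closedin_closure_of openin_Un openin_diff openin_topspace)
  qed
qed simp

text \<open>The open set \<open>below k\<close> is disjoint from \<open>X k\<close>, hence from its
  closure, and \<open>X (Suc k)\<close> avoids that closure by construction. Any other point outside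
  the closure would have been put into \<open>X (Suc k)\<close>.\<close>

lemma closure_of_X: "W closure_of X k = topspace W - below k - X (Suc k)"
proof -
  have "below k \<inter> W closure_of X k = {}"
    using X_disjoint_below[of k k] openin_Int_closure_of_eq_empty[OF openin_below, of k "X k"] by blast
  moreover have "X (Suc k) \<inter> W closure_of X k = {}"
    by (auto simp: X_Suc)
  ultimately show ?thesis
    using closure_of_X_complement[of k] closure_of_subset_topspace[of W "X k"] by blast
qed

lemma X_subset_closure_of_X:
  assumes "k = j \<or> j + 2 \<le> k"
  shows "X k \<subseteq> W closure_of X j"
  using assms X_disjoint_below[of j k] X_disjoint[of k "Suc j"] X_subset_topspace[of k]
  by (auto simp: closure_of_X)

lemma R_subset_closure_of_X: "R \<subseteq> W closure_of X j"
  by (auto simp: closure_of_X R_def below_def)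

text \<open>The union of the strata whose index lies above \<open>p\<^sub>k\<close> in the order,
  the natural trim neighbourhood of \<open>X k\<close>. Truncated subtraction makes
  \<open>below (k - 1)\<close> empty for \<open>k = 0\<close> and \<open>k = 1\<close>, in
  accordance with the maximality of these two elements.\<close>

definition star :: "nat \<Rightarrow> 'a set" where
  "star k = X k \<union> below (k - 1)"

lemma openin_star: "openin W (star k)"
proof (cases k)
  case 0
  then show ?thesis
    using openin_generator by (simp add: star_def)
next
  case (Suc j)
  \<comment> \<open>The closure rule read backwards: the star of \<open>Suc j\<close> is the
    complement of the closure of \<open>X j\<close>.\<close>
  have "star k = topspace W - W closure_of X j"
    using below_subset_topspace[of j] X_subset_topspace[of "Suc j"]
    by (auto simp: closure_of_X star_def Suc)
  then show ?thesis
    by (simp add: openin_diff)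
qed

lemma star_meets_X:
  assumes "x \<in> star k" and "x \<in> X j"
  shows "k = j \<or> j + 2 \<le> k"
  using assms X_index_unique by (force simp: star_def below_def)

lemma star_point:
  assumes "x \<in> star k"
  obtains j where "x \<in> X j" "k = j \<or> j + 2 \<le> k"
proof -
  obtain j where "x \<in> X j"
    using assms by (auto simp: star_def below_def)
  then show ?thesis
    using that star_meets_X[OF assms] by blast
qed

text \<open>The closure of an empty \<open>X j\<close> is empty, yet it contains \<open>R\<close>
  and every \<open>X k\<close> with \<open>j + 2 \<le> k\<close>.\<close>

lemma X_empty_imp:
  assumes "j \<notin> K"
  shows "R = {}" and "j + 2 \<le> k \<Longrightarrow> k \<notin> K"
  using assms R_subset_closure_of_X[of j] X_subset_closure_of_X[of k j] by (auto simp: K_def)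

text \<open>Let \<open>m + 1\<close> be the least missing index; it is positive because
  \<open>X 0 = A\<close> is non-empty. By \<open>X_empty_imp\<close> everything from
  \<open>m + 3\<close> on is missing too, so only \<open>m + 2\<close> is undecided.\<close>

lemma K_initial_segment:
  assumes "K \<noteq> UNIV"
  shows "\<exists>m. \<exists>n\<in>{0, 2 :: nat}. K = {0..m} \<union> (if n = 2 then {m + 2} else {})"
proof -
  define j where "j = (LEAST j. j \<notin> K)"
  have j: "j \<notin> K" "\<And>i. i < j \<Longrightarrow> i \<in> K"
    using assms LeastI_ex[of "\<lambda>j. j \<notin> K"] not_less_Least[of _ "\<lambda>j. j \<notin> K"]
    unfolding j_def by blast+
  moreover have "0 \<in> K"
    using generator_nonempty by (simp add: K_def)
  ultimately obtain m where m: "j = Suc m"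
    by (metis not0_implies_Suc)
  have in_K: "k \<in> K \<longleftrightarrow> k \<le> m \<or> k = m + 2 \<and> m + 2 \<in> K" for k
  proof -
    consider "k \<le> m" | "k = Suc m" | "k = m + 2" | "j + 2 \<le> k"
      unfolding m by linarith
    then show ?thesis
      using j X_empty_imp(2)[OF j(1), of k] unfolding m by cases auto
  qed
  define n :: nat where "n = (if m + 2 \<in> K then 2 else 0)"
  have "K = {0..m} \<union> (if n = 2 then {m + 2} else {})"
  proof (rule Set.set_eqI)
    show "k \<in> K \<longleftrightarrow> k \<in> {0..m} \<union> (if n = 2 then {m + 2} else {})" for k
      using in_K[of k] by (simp add: n_def)
  qed
  moreover have "n \<in> {0, 2}"
    by (simp add: n_def)
  ultimately show ?thesis
    by blast
qed

lemma R_nonempty_imp: "R \<noteq> {} \<Longrightarrow> K = UNIV"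
  using X_empty_imp(1) by blast

section \<open>The generated closure algebra\<close>

text \<open>This restricts a set only on the strata; its trace on \<open>R\<close> remains
  arbitrary.\<close>

definition saturated :: "'a set \<Rightarrow> bool" where
  "saturated a \<longleftrightarrow> (\<forall>k. X k \<subseteq> a \<or> X k \<inter> a = {})"

text \<open>An explicit form of the generated algebra. The bound by \<open>below n\<close> makes a
  member a finite union of strata or the complement of one; in particular it misses \<open>R\<close>
  or contains all of it.\<close>

definition C :: "'a set set" where
  "C = {a. a \<subseteq> topspace W \<and> saturated a \<and> (\<exists>n. a \<subseteq> below n \<or> topspace W - below n \<subseteq> a)}"

text \<open>The restriction to \<open>K\<close> discards the empty strata, which are contained in
  every set.\<close>

definition f :: "'a set \<Rightarrow> nat set" where
  "f a = {k \<in> K. X k \<subseteq> a}"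

section \<open>Closures of saturated sets, computed on indices\<close>

lemma saturatedD: "saturated a \<Longrightarrow> x \<in> X k \<Longrightarrow> x \<in> a \<Longrightarrow> X k \<subseteq> a"
  unfolding saturated_def by blast

lemma f_iff: "saturated a \<Longrightarrow> x \<in> X k \<Longrightarrow> x \<in> a \<longleftrightarrow> k \<in> f a"
  unfolding saturated_def f_def K_def by blast

lemma saturated_Un: "saturated a \<Longrightarrow> saturated b \<Longrightarrow> saturated (a \<union> b)"
  unfolding saturated_def by blast

lemma saturated_compl: "saturated a \<Longrightarrow> saturated (topspace W - a)"
  using X_subset_topspace unfolding saturated_def by blast

text \<open>The star of \<open>p\<close> is a neighbourhood of \<open>x\<close>, so it meets
  \<open>a\<close> in a point of some stratum above \<open>p\<close>, and saturation puts the index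
  of that stratum into \<open>f a\<close>.\<close>

lemma closure_of_meets_X:
  assumes "saturated a" and "x \<in> X p" and "x \<in> W closure_of a"
  shows "\<exists>q\<in>f a. p = q \<or> q + 2 \<le> p"
proof -
  have "x \<in> star p"
    using assms(2) by (simp add: star_def)
  then obtain y where y: "y \<in> star p" "y \<in> a"
    using assms(3) openin_Int_closure_of_eq_empty[OF openin_star, of p a] by blast
  obtain q where "y \<in> X q" "p = q \<or> q + 2 \<le> p"
    using star_point[OF y(1)] .
  then show ?thesis
    using y(2) f_iff[OF assms(1)] by (intro bexI[of _ q]) auto
qed

lemma X_subset_closure_of:
  assumes "q \<in> f a" and "p = q \<or> q + 2 \<le> p"
  shows "X p \<subseteq> W closure_of a"
  using X_subset_closure_of_X[OF assms(2)] closure_of_mono[of "X q" a W] assms(1) by (auto simp: f_def)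

lemma saturated_closure_of:
  assumes "saturated a"
  shows "saturated (W closure_of a)"
  unfolding saturated_def
proof (intro allI disjCI)
  fix k
  assume "X k \<inter> W closure_of a \<noteq> {}"
  then obtain x where "x \<in> X k" "x \<in> W closure_of a"
    by blast
  from closure_of_meets_X[OF assms this] show "X k \<subseteq> W closure_of a"
    by (elim bexE) (rule X_subset_closure_of)
qed

lemma f_closure_of:
  assumes "saturated a"
  shows "f (W closure_of a) = {p \<in> K. \<exists>q\<in>f a. p = q \<or> q + 2 \<le> p}"
proof -
  have "(p \<in> f (W closure_of a)) = (\<exists>q\<in>f a. p = q \<or> q + 2 \<le> p)" if p: "p \<in> K" for p
  proof -
    obtain x where x: "x \<in> X p"
      using p by (auto simp: K_def)
    have "p \<in> f (W closure_of a) \<longleftrightarrow> x \<in> W closure_of a"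
      using f_iff[OF saturated_closure_of[OF assms] x] by simp
    also have "\<dots> \<longleftrightarrow> (\<exists>q\<in>f a. p = q \<or> q + 2 \<le> p)"
    proof
      show "\<exists>q\<in>f a. p = q \<or> q + 2 \<le> p" if "x \<in> W closure_of a"
        using assms x that by (rule closure_of_meets_X)
    next
      assume "\<exists>q\<in>f a. p = q \<or> q + 2 \<le> p"
      then obtain q where "q \<in> f a" "p = q \<or> q + 2 \<le> p"
        by (elim bexE)
      from X_subset_closure_of[OF this] show "x \<in> W closure_of a"
        using x by (rule subsetD)
    qed
    finally show ?thesis .
  qed
  then show ?thesis
    by (auto simp: f_def)
qed

lemma closure_of_in_C:
  assumes "a \<in> C"
  shows "W closure_of a \<in> C"
proof -
  have sat: "saturated a"
    using assms by (simp add: C_def)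
  have "\<exists>n. W closure_of a \<subseteq> below n \<or> topspace W - below n \<subseteq> W closure_of a"
  proof (cases "a = {}")
    case False
    obtain n where "a \<subseteq> below n \<or> topspace W - below n \<subseteq> a"
      using assms by (auto simp: C_def)
    then show ?thesis
    proof
      assume "a \<subseteq> below n"
      then obtain x q where x: "x \<in> a" "x \<in> X q"
        using False by (force simp: below_def)
      \<comment> \<open>The closure of a single stratum already omits only finitely many strata, so
        the closure of a non-empty member of \<open>C\<close> is always of the second kind.\<close>
      have "topspace W - below (q + 2) \<subseteq> W closure_of X q"
        by (auto simp: closure_of_X below_Suc)
      also have "\<dots> \<subseteq> W closure_of a"
        using saturatedD[OF sat x(2,1)] by (rule closure_of_mono)
      finally show ?thesis
        by blast
    next
      assume "topspace W - below n \<subseteq> a"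
      then show ?thesis
        using closure_of_subset[of a W] assms by (auto simp: C_def)
    qed
  qed simp
  then show ?thesis
    using saturated_closure_of[OF sat] by (simp add: C_def closure_of_subset_topspace)
qed

section \<open>\<open>C\<close> as the least closure subalgebra containing \<open>A\<close>\<close>

lemma Un_in_C:
  assumes "a \<in> C" and "b \<in> C"
  shows "a \<union> b \<in> C"
proof -
  obtain m n where "a \<subseteq> below m \<or> topspace W - below m \<subseteq> a"
    and "b \<subseteq> below n \<or> topspace W - below n \<subseteq> b"
    using assms by (auto simp: C_def)
  then have "a \<union> b \<subseteq> below (max m n) \<or> topspace W - below (max m n) \<subseteq> a \<union> b"
    using below_mono[of m "max m n"] below_mono[of n "max m n"] by auto
  then show ?thesis
    using assms saturated_Un by (auto simp: C_def)
qed

lemma compl_in_C: "a \<in> C \<Longrightarrow> topspace W - a \<in> C"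
  unfolding C_def using saturated_compl by auto

lemma empty_in_C: "{} \<in> C"
  by (simp add: C_def saturated_def)

lemma X_in_C: "X k \<in> C"
proof -
  have "X j \<subseteq> X k \<or> X j \<inter> X k = {}" for j
    by (cases "j = k") (simp_all add: X_disjoint)
  then have "saturated (X k)"
    by (simp add: saturated_def)
  moreover have "X k \<subseteq> below (Suc k)"
    by (simp add: below_Suc)
  ultimately show ?thesis
    using X_subset_topspace by (auto simp: C_def)
qed

lemma closure_subalgebra_C: "closure_subalgebra W C"
proof -
  have "a \<inter> b \<in> C" if "a \<in> C" "b \<in> C" for a b
  proof -
    have "a \<inter> b = topspace W - ((topspace W - a) \<union> (topspace W - b))"
      using that by (auto simp: C_def)
    then show ?thesis
      using that Un_in_C compl_in_C by metis
  qed
  then show ?thesis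
    unfolding closure_subalgebra_def
    using Un_in_C compl_in_C closure_of_in_C empty_in_C compl_in_C[OF empty_in_C]
    by (auto simp: C_def)
qed

text \<open>Each stratum arises from the earlier ones by a finite union, a closure and a complement;
  strong induction is needed since all earlier strata enter.\<close>

lemma X_in_closure_subalgebra:
  assumes "closure_subalgebra W D" and "A \<in> D"
  shows "X k \<in> D"
proof (induction k rule: less_induct)
  case (less k)
  show ?case
  proof (cases k)
    case 0
    then show ?thesis
      using assms(2) by simp
  next
    case (Suc j)
    have "below k \<in> D"
      unfolding below_def using less by (intro closure_subalgebra_Union[OF assms(1)]) auto
    moreover have "W closure_of X j \<in> D"
      using less[of j] assms(1) by (simp add: Suc closure_subalgebra_def)
    ultimately have "topspace W - (below k \<union> W closure_of X j) \<in> D"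
      using assms(1) by (simp add: closure_subalgebra_def)
    moreover have "topspace W - (below k \<union> W closure_of X j) = X k"
      unfolding Suc X_Suc by blast
    ultimately show ?thesis
      by simp
  qed
qed

lemma generated_eq_C: "generated_closure_subalgebra W {A} = C"
proof (rule hull_unique)
  show "{A} \<subseteq> C"
    using X_in_C[of 0] by simp
  show "closure_subalgebra W C"
    by (rule closure_subalgebra_C)
  fix D
  assume "{A} \<subseteq> D" and D: "closure_subalgebra W D"
  then have X_D: "X k \<in> D" for k
    by (simp add: X_in_closure_subalgebra)
  have fin: "a \<in> D" if "saturated a" "a \<subseteq> below n" for a n
  proof -
    \<comment> \<open>Intersecting with \<open>{..<n}\<close> loses nothing, as \<open>a\<close>
      lies in \<open>below n\<close>, and makes the index set visibly finite.\<close>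
    have "a = \<Union>(X ` (f a \<inter> {..<n}))"
    proof (rule Set.set_eqI)
      show "x \<in> a \<longleftrightarrow> x \<in> \<Union>(X ` (f a \<inter> {..<n}))" for x
        using that(2) f_iff[OF that(1)] by (force simp: below_def)
    qed
    moreover have "\<Union>(X ` (f a \<inter> {..<n})) \<in> D"
      using X_D by (intro closure_subalgebra_Union[OF D]) auto
    ultimately show ?thesis
      by simp
  qed
  show "C \<subseteq> D"
  proof
    fix a
    assume a: "a \<in> C"
    then obtain n where "a \<subseteq> below n \<or> topspace W - below n \<subseteq> a"
      by (auto simp: C_def)
    then show "a \<in> D"
    proof
      assume "topspace W - below n \<subseteq> a"
      then have "topspace W - a \<in> D"
        using a saturated_compl by (intro fin[of _ n]) (auto simp: C_def)
      then have "topspace W - (topspace W - a) \<in> D"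
        using D by (simp add: closure_subalgebra_def)
      then show ?thesis
        using a by (simp add: C_def double_diff)
    qed (use a fin in \<open>auto simp: C_def\<close>)
  qed
qed

section \<open>The isomorphism onto the finite and cofinite subsets of \<open>K\<close>\<close>

lemma finite_f:
  assumes "a \<subseteq> below n"
  shows "finite (f a)"
proof -
  have "f a \<subseteq> {..<n}"
  proof
    fix k
    assume "k \<in> f a"
    then obtain x where x: "x \<in> X k" "x \<in> below n"
      using assms by (auto simp: f_def K_def)
    then obtain j where "j < n" "x \<in> X j"
      by (auto simp: below_def)
    then show "k \<in> {..<n}"
      using X_index_unique[OF x(1)] by simp
  qed
  then show ?thesis
    by (rule finite_subset) simp
qed

lemma f_compl: "saturated a \<Longrightarrow> f (topspace W - a) = K - f a"
  using X_subset_topspace unfolding f_def K_def saturated_def by blast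

text \<open>Here \<open>K\<close> is infinite because \<open>R\<close> is non-empty. A member of
  \<open>C\<close> inside some \<open>below n\<close> misses \<open>R\<close> and has a finite index
  set; one containing the complement of \<open>below n\<close> contains \<open>R\<close> and has a
  cofinite, hence infinite, index set. So \<open>f a\<close> also decides membership on
  \<open>R\<close>, as injectivity requires.\<close>

lemma R_iff_infinite:
  assumes a: "a \<in> C" and x: "x \<in> R"
  shows "x \<in> a \<longleftrightarrow> infinite (f a)"
proof -
  have x': "x \<in> topspace W" "x \<notin> below n" for n
    using x by (auto simp: R_def below_def)
  have K: "infinite K"
    using x R_nonempty_imp by (metis empty_iff infinite_UNIV_nat)
  obtain n where "a \<subseteq> below n \<or> topspace W - below n \<subseteq> a"
    using a by (auto simp: C_def)
  then show ?thesis
  proof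
    assume "a \<subseteq> below n"
    then show ?thesis
      using x'(2) finite_f by blast
  next
    assume n: "topspace W - below n \<subseteq> a"
    then have "finite (f (topspace W - a))"
      by (intro finite_f[of _ n]) blast
    then have "finite (K - f a)"
      using a by (simp add: f_compl C_def)
    then have "infinite (f a)"
      using K finite_Diff2 by blast
    then show ?thesis
      using x' n by blast
  qed
qed

lemma inj_on_f: "inj_on f C"
proof (rule inj_onI, rule Set.set_eqI)
  fix a b x
  assume ab: "a \<in> C" "b \<in> C" "f a = f b"
  show "x \<in> a \<longleftrightarrow> x \<in> b"
  proof (cases "x \<in> topspace W")
    case True
    then show ?thesis
    proof (cases rule: point_cases)
      case (1 k)
      then show ?thesis
        using f_iff[of a x k] f_iff[of b x k] ab by (simp add: C_def)
    next
      case 2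
      then show ?thesis
        using R_iff_infinite ab by simp
    qed
  next
    case False
    then show ?thesis
      using ab by (auto simp: C_def)
  qed
qed

lemma f_UN_X: "S \<subseteq> K \<Longrightarrow> f (\<Union>k\<in>S. X k) = S"
  using X_index_unique unfolding f_def K_def by blast

lemma f_image_C: "f ` C = {S. S \<subseteq> K \<and> (finite S \<or> finite (K - S))}"
proof (intro equalityI subsetI)
  fix S
  assume "S \<in> f ` C"
  then obtain a where a: "a \<in> C" "S = f a"
    by blast
  then obtain n where "a \<subseteq> below n \<or> topspace W - below n \<subseteq> a"
    by (auto simp: C_def)
  then have "a \<subseteq> below n \<or> topspace W - a \<subseteq> below n"
    by blast
  then have "finite S \<or> finite (K - S)"
    using finite_f[of a n] finite_f[of "topspace W - a" n] f_compl[of a] a by (auto simp: C_def)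
  then show "S \<in> {S. S \<subseteq> K \<and> (finite S \<or> finite (K - S))}"
    using a(2) by (simp add: f_def)
next
  fix S
  assume S: "S \<in> {S. S \<subseteq> K \<and> (finite S \<or> finite (K - S))}"
  have fin: "(\<Union>k\<in>T. X k) \<in> C" if "finite T" for T
    using that X_in_C by (intro closure_subalgebra_Union[OF closure_subalgebra_C]) auto
  show "S \<in> f ` C"
  proof (cases "finite S")
    case True
    then show ?thesis
      using S fin f_UN_X by (metis (no_types, lifting) image_eqI mem_Collect_eq)
  next
    case False
    \<comment> \<open>The preimage of a cofinite \<open>S\<close> is the complement of the missing
      strata, so that it includes \<open>R\<close>; the union of the strata indexed by
      \<open>S\<close> would leave \<open>C\<close> when \<open>R\<close> is non-empty.\<close>
    let ?b = "\<Union>k\<in>K - S. X k"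
    have b: "?b \<in> C"
      using S False by (intro fin) simp
    then have "f (topspace W - ?b) = K - f ?b"
      by (intro f_compl) (simp add: C_def)
    also have "\<dots> = S"
      using S by (simp add: f_UN_X double_diff)
    finally show ?thesis
      using compl_in_C[OF b] by blast
  qed
qed

lemma closure_algebra_iso_f:
  "closure_algebra_iso W C (poset_topology (P_inf\<lparr>carrier := K\<rparr>)) (\<E> (P_inf\<lparr>carrier := K\<rparr>)) f"
proof -
  have sat: "saturated a" if "a \<in> C" for a
    using that by (simp add: C_def)
  have "bij_betw f C (\<E> (P_inf\<lparr>carrier := K\<rparr>))"
    using inj_on_f f_image_C by (simp add: bij_betw_def lower_set_algebra_P_inf_carrier)
  moreover have "f {} = {}" "f (topspace W) = K"
    using X_subset_topspace by (auto simp: f_def K_def)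
  moreover have "f (a \<union> b) = f a \<union> f b \<and> f (a \<inter> b) = f a \<inter> f b" if "a \<in> C" "b \<in> C" for a b
    using sat[OF that(1)] sat[OF that(2)] unfolding f_def saturated_def by blast
  moreover have "f (W closure_of a) = poset_topology (P_inf\<lparr>carrier := K\<rparr>) closure_of f a"
    if "a \<in> C" for a
    using closure_of_poset_topology[OF partial_order_P_inf_carrier, of "f a" K] f_closure_of[OF sat[OF that]]
    by (auto simp: f_def)
  ultimately show ?thesis
    using sat f_compl by (simp add: closure_algebra_iso_def)
qed

section \<open>Atoms and the residue\<close>

lemma f_X: "k \<in> K \<Longrightarrow> f (X k) = {k}"
  using f_UN_X[of "{k}"] by simp

text \<open>Injectivity of \<open>f\<close> gives every non-empty member of \<open>C\<close> a
  non-empty index set, so it contains a non-empty stratum and no atom can hide inside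
  \<open>R\<close>. Strata are minimal by saturation.\<close>

lemma atoms_C: "atoms C = X ` K"
proof (intro equalityI subsetI)
  fix B
  assume B: "B \<in> atoms C"
  then have "B \<in> C" "B \<noteq> {}"
    by (simp_all add: atoms_def)
  then have "f B \<noteq> f {}"
    using inj_onD[OF inj_on_f _ _ empty_in_C] by blast
  moreover have "f {} = {}"
    by (simp add: f_def K_def)
  ultimately obtain k where "k \<in> K" "X k \<subseteq> B"
    by (auto simp: f_def)
  then show "B \<in> X ` K"
    using B X_in_C[of k] by (auto simp: atoms_def K_def)
next
  fix B
  assume "B \<in> X ` K"
  then obtain k where k: "k \<in> K" "B = X k"
    by blast
  have "D = {} \<or> D = X k" if "D \<in> C" "D \<subseteq> X k" for D
    using that unfolding C_def saturated_def by blast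
  then show "B \<in> atoms C"
    using k X_in_C by (simp add: atoms_def K_def)
qed

lemma bij_betw_X: "bij_betw X K (atoms C)"
proof -
  have "i = k" if "i \<in> K" "k \<in> K" "X i = X k" for i k
  proof -
    have "f (X i) = f (X k)"
      by (simp only: that(3))
    then show ?thesis
      by (simp only: f_X that(1,2) singleton_inject)
  qed
  then show ?thesis
    by (simp add: bij_betw_def atoms_C inj_on_def)
qed

lemma UN_X_K: "(\<Union>k\<in>K. X k) = (\<Union>k. X k)"
  unfolding K_def by blast

lemma residue_infinity_eq_R: "residue_infinity W A = R"
  by (simp add: residue_infinity_def generated_eq_C atoms_C R_def UN_X_K)

section \<open>The two trim partitions\<close>

lemma trim_partition_P_inf_carrier:
  assumes "R = {}"
  shows "complete_partition (P_inf\<lparr>carrier := K\<rparr>) W X"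
    and "trim_partition (P_inf\<lparr>carrier := K\<rparr>) W X"
proof -
  have "(\<Union>k\<in>K. X k) = topspace W"
    using assms X_subset_topspace by (auto simp: UN_X_K R_def)
  then show comp: "complete_partition (P_inf\<lparr>carrier := K\<rparr>) W X"
    using X_disjoint X_subset_topspace
    by (auto simp: complete_partition_def poset_partition_def disjoint_family_on_def K_def)
  show "trim_partition (P_inf\<lparr>carrier := K\<rparr>) W X"
  proof (rule trim_partitionI[OF partial_order_P_inf_carrier comp])
    fix p
    show "\<exists>U. openin W U \<and> X p \<subseteq> U \<and> partition_type (P_inf\<lparr>carrier := K\<rparr>) X U \<subseteq>
      {q \<in> carrier (P_inf\<lparr>carrier := K\<rparr>). p \<sqsubseteq>\<^bsub>P_inf\<lparr>carrier := K\<rparr>\<^esub> q}"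
      using openin_star[of p] star_meets_X[of _ p]
      by (intro exI[of _ "star p"]) (auto simp: partition_type_def star_def)
  qed (use X_subset_closure_of_X in auto)
qed

lemma P_inf_bot_simps [simp]:
  "carrier P_inf_bot = UNIV"
  "None \<sqsubseteq>\<^bsub>P_inf_bot\<^esub> q"
  "\<not> Some k \<sqsubseteq>\<^bsub>P_inf_bot\<^esub> None"
  "Some k \<sqsubseteq>\<^bsub>P_inf_bot\<^esub> Some j \<longleftrightarrow> k = j \<or> j + 2 \<le> k"
  by (auto simp: P_inf_bot_def P_inf_def)

lemma trim_partition_P_inf_bot:
  assumes "R \<noteq> {}"
  shows "complete_partition P_inf_bot W (case_option R X)"
    and "trim_partition P_inf_bot W (case_option R X)"
proof -
  have "X k \<noteq> {}" for k
    using R_nonempty_imp[OF assms] by (auto simp: K_def)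
  moreover have "(\<Union>p. case_option R X p) = topspace W"
    using X_subset_topspace by (auto simp: UNIV_option_conv R_def)
  moreover have "case_option R X p \<inter> case_option R X q = {}" if "p \<noteq> q" for p q
    using that X_disjoint by (cases p; cases q) (auto simp: R_def)
  moreover have "R \<subseteq> topspace W"
    by (auto simp: R_def)
  ultimately show comp: "complete_partition P_inf_bot W (case_option R X)"
    using assms X_subset_topspace
    by (simp add: complete_partition_def poset_partition_def disjoint_family_on_def split: option.split)
  show "trim_partition P_inf_bot W (case_option R X)"
  proof (rule trim_partitionI[OF partial_order_P_inf_bot comp])
    fix p
    show "\<exists>U. openin W U \<and> case_option R X p \<subseteq> U \<and>
      partition_type P_inf_bot (case_option R X) U \<subseteq> {q \<in> carrier P_inf_bot. p \<sqsubseteq>\<^bsub>P_inf_bot\<^esub> q}"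
    proof (cases p)
      case None
      \<comment> \<open>Every element lies above \<bottom>, so the whole space serves as the
        neighbourhood of \<open>R\<close>.\<close>
      then show ?thesis
        by (intro exI[of _ "topspace W"]) (auto simp: R_def)
    next
      case (Some k)
      \<comment> \<open>The star of \<open>k\<close> is a union of strata and misses
        \<open>R\<close>, which excludes \<open>q = None\<close>.\<close>
      have "Some k \<sqsubseteq>\<^bsub>P_inf_bot\<^esub> q" if "x \<in> star k" "x \<in> case_option R X q" for x q
      proof (cases q)
        case None
        then show ?thesis
          using that by (auto simp: R_def star_def below_def)
      next
        case (Some j)
        then show ?thesis
          using that star_meets_X[of x k j] by simp
      qed
      then show ?thesis
        using openin_star[of k]
        by (intro exI[of _ "star k"]) (auto simp: partition_type_def star_def Some)
    qed
  next
    show "case_option R X p \<subseteq> W closure_of (case_option R X q)" if "p \<sqsubseteq>\<^bsub>P_inf_bot\<^esub> q" for p q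
      using that R_subset_closure_of_X X_subset_closure_of_X closure_of_subset[of R W]
      by (cases p; cases q) (auto simp: R_def)
  qed
qed

end

theorem theorem7p2:
  fixes W :: "'a topology" and A :: "'a set"
  assumes "openin W A" and "A \<noteq> {}"
  defines "C \<equiv> generated_closure_subalgebra W {A}"
  shows "\<exists>P f X.
    (P = P_inf \<or> (\<exists>(m, n)\<in>J. P = P_fin m n)) \<and>
    closure_algebra_iso W C (poset_topology P) (\<E> P) f \<and>
    bij_betw X (carrier P) (atoms C) \<and> (\<forall>p\<in>carrier P. f (X p) = {p}) \<and>
    (residue_infinity W A = {} \<longrightarrow>
       complete_partition P W X \<and> trim_partition P W X) \<and>
    (residue_infinity W A \<noteq> {} \<longrightarrow>
       P = P_inf \<and>
       complete_partition P_inf_bot W (case_option (residue_infinity W A) X) \<and>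
       trim_partition P_inf_bot W (case_option (residue_infinity W A) X))"
proof -
  interpret G: open_generator W A
    using assms(1,2) by unfold_locales
  let ?P = "P_inf\<lparr>carrier := G.K\<rparr>"
  \<comment> \<open>With full index set the carrier update changes nothing; by
    \<open>G.R_nonempty_imp\<close> this covers the case of a non-empty residue.\<close>
  have full: "?P = P_inf" if "G.K = UNIV"
    using that by (simp add: P_inf_def)
  have shape: "?P = P_inf \<or> (\<exists>(m, n)\<in>J. ?P = P_fin m n)"
  proof (cases "G.K = UNIV")
    case False
    then obtain m and n :: nat where "n \<in> {0, 2}" "G.K = {0..m} \<union> (if n = 2 then {m + 2} else {})"
      using G.K_initial_segment by blast
    then have "(m, n) \<in> J" "?P = P_fin m n"
      by (simp_all add: J_def P_fin_def)
    then show ?thesis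
      by blast
  qed (use full in simp)
  have C: "C = G.C"
    by (simp add: C_def G.generated_eq_C)
  show ?thesis
    unfolding C G.residue_infinity_eq_R
    using shape G.closure_algebra_iso_f G.bij_betw_X G.f_X G.trim_partition_P_inf_carrier
      G.trim_partition_P_inf_bot full[OF G.R_nonempty_imp]
    by (intro exI[of _ ?P] exI[of _ G.f] exI[of _ G.X]) simp
qed

end
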